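(* Let $n\ge d\ge2$, let $X\in\mathbb{R}^{n\times d}$ have rank $d$, and let $P=XX^\top$. Let $V\in\mathbb{R}^{n\times d}$ be an orthonormal basis for $\operatorname{col}(P)$ (orthonormal columns spanning the column space) and let the columns of $V_\perp\in\mathbb{R}^{n\times(n-d)}$ span its orthogonal complement. Then any realizable $\dot P$, i.e. $\dot P=\dot XX^\top+X\dot X^\top$ for some $\dot X\in\mathbb{R}^{n\times d}$, satisfies $$V_\perp^\top\dot PV_\perp=0.$$ The realizable tangent space $\{\dot XX^\top+X\dot X^\top:\dot X\in\mathbb{R}^{n\times d}\}$ has dimension $nd-d(d-1)/2$.
   Context: $\operatorname{col}(P)$ denotes the column space of $P$. *)

theory Defs
  imports
    Complex_Main
    "Jordan_Normal_Form.DL_Rank"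
begin

abbreviation real_col_space :: "nat \<Rightarrow> real mat \<Rightarrow> real vec set" where
  "real_col_space n A \<equiv> vec_space.col_space n A"

text \<open>The bilinear form used by the library's \<open>orthogonal_complement\<close> is the
  standard dot product, which over the reals is the Euclidean inner product.\<close>

abbreviation real_orth_compl :: "nat \<Rightarrow> real vec set \<Rightarrow> real vec set" where
  "real_orth_compl n W \<equiv> vec_module.orthogonal_complement n W"

definition orthonormal_cols :: "real mat \<Rightarrow> bool" where
  "orthonormal_cols V \<longleftrightarrow>
     (\<forall>i < dim_col V. \<forall>j < dim_col V. col V i \<bullet> col V j = (if i = j then 1 else 0))"

definition realizable_tangent_space :: "nat \<Rightarrow> nat \<Rightarrow> real mat \<Rightarrow> real mat set" where
  "realizable_tangent_space n d X =
     {Xdot * X\<^sup>T + X * Xdot\<^sup>T | Xdot. Xdot \<in> carrier_mat n d}"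

text \<open>Dimension of a set \<open>W\<close> of \<open>n\<close> by \<open>n\<close> real matrices, regarded as a real vector space
  with the operations of the full matrix space; meaningful when \<open>W\<close> is a linear subspace.\<close>

definition mat_subspace_dim :: "nat \<Rightarrow> real mat set \<Rightarrow> nat" where
  "mat_subspace_dim n W =
     vectorspace.dim class_ring ((module_mat TYPE(real) n n)\<lparr>carrier := W\<rparr>)"

lemma subspace_realizable_tangent_space:
  assumes X: "X \<in> carrier_mat n d"
  shows "VectorSpace.subspace class_ring (realizable_tangent_space n d X)
    (module_mat TYPE(real) n n)"
proof -
  interpret matrix_vs n n "TYPE(real)" .
  have XT: "X\<^sup>T \<in> carrier_mat d n" using X by simp
  show ?thesis
  proof (rule subspace.intro)
    show "vectorspace class_ring V" by (rule matrix_vs)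
    show "submodule class_ring (realizable_tangent_space n d X) V"
    proof (rule submodule.intro, goal_cases)
      case 1
      show ?case by (rule module_axioms)
    next
      case 2
      show ?case using X by (auto simp: realizable_tangent_space_def module_mat_simps)
    next
      case (3 A B)
      then obtain A' B' where
        A': "A' \<in> carrier_mat n d" "A = A' * X\<^sup>T + X * A'\<^sup>T" and
        B': "B' \<in> carrier_mat n d" "B = B' * X\<^sup>T + X * B'\<^sup>T"
        unfolding realizable_tangent_space_def by blast
      have "A + B = (A' + B') * X\<^sup>T + X * (A' + B')\<^sup>T"
      proof -
        have eq1: "(A' + B') * X\<^sup>T = A' * X\<^sup>T + B' * X\<^sup>T"
          by (rule add_mult_distrib_mat[OF A'(1) B'(1) XT])
        have eq2: "X * (A' + B')\<^sup>T = X * A'\<^sup>T + X * B'\<^sup>T"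
          using mult_add_distrib_mat[OF X, of "A'\<^sup>T" n "B'\<^sup>T"] A'(1) B'(1)
          by (simp add: transpose_add)
        have swap: "(p + q) + (r + s) = (p + r) + (q + s)"
          if "p \<in> carrier_mat n n" "q \<in> carrier_mat n n" "r \<in> carrier_mat n n"
            "s \<in> carrier_mat n n" for p q r s :: "real mat"
          using that by (intro eq_matI) auto
        show ?thesis
          unfolding A'(2) B'(2) eq1 eq2 by (rule swap) (use A'(1) B'(1) X in auto)
      qed
      then show ?case
        unfolding realizable_tangent_space_def module_mat_simps
        using A'(1) B'(1) by auto
    next
      case 4
      have "0\<^sub>m n n = 0\<^sub>m n d * X\<^sup>T + X * (0\<^sub>m n d)\<^sup>T"
        using X XT by simp
      then show ?case
        unfolding realizable_tangent_space_def module_mat_simps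
        using zero_carrier_mat[of n d] by blast
    next
      case (5 c A)
      then obtain A' where
        A': "A' \<in> carrier_mat n d" "A = A' * X\<^sup>T + X * A'\<^sup>T"
        unfolding realizable_tangent_space_def by blast
      have tr: "(c \<cdot>\<^sub>m A')\<^sup>T = c \<cdot>\<^sub>m A'\<^sup>T" by (intro eq_matI) auto
      have "(c \<cdot>\<^sub>m A') * X\<^sup>T = c \<cdot>\<^sub>m (A' * X\<^sup>T)"
        by (rule mult_smult_assoc_mat[OF A'(1) XT])
      moreover have "X * (c \<cdot>\<^sub>m A'\<^sup>T) = c \<cdot>\<^sub>m (X * A'\<^sup>T)"
        by (rule mult_smult_distrib[OF X]) (use A'(1) in simp)
      moreover have "c \<cdot>\<^sub>m (A' * X\<^sup>T + X * A'\<^sup>T) =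
          c \<cdot>\<^sub>m (A' * X\<^sup>T) + c \<cdot>\<^sub>m (X * A'\<^sup>T)"
        by (rule add_smult_distrib_left_mat[of _ n n]) (use A'(1) X in auto)
      ultimately have "c \<cdot>\<^sub>m A = (c \<cdot>\<^sub>m A') * X\<^sup>T + X * (c \<cdot>\<^sub>m A')\<^sup>T"
        unfolding A'(2) tr by simp
      then show ?case
        unfolding realizable_tangent_space_def module_mat_simps
        using A'(1) by auto
    qed
  qed
qed

end

theory Submission
  imports Defs
begin

text \<open>The first claim holds because the columns of \<open>Vperp\<close> lie in the kernel of \<open>X\<^sup>T\<close>.
  For the dimension, complete the columns of \<open>X\<close> to a basis of the whole space, so that
  \<open>X = H J\<close> with \<open>H\<close> invertible and \<open>J\<close> the first \<open>d\<close> columns of the identity. The congruence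
  \<open>M \<mapsto> H M H\<^sup>T\<close> identifies the tangent space at \<open>J\<close> with the one at \<open>X\<close>, and the
  former consists of the symmetric matrices with vanishing lower right block, which have
  \<open>n + (n - 1) + \<dots> + (n - d + 1)\<close> free entries.\<close>

section \<open>Completing a full-rank matrix to an invertible one\<close>

text \<open>A maximal independent subset of the set of columns has \<open>rank A = nc\<close>
  elements, while the list of columns has length \<open>nc\<close>; hence no column repeats.\<close>

lemma (in vec_space) full_rank_cols:
  assumes A: "A \<in> carrier_mat n nc" and rank: "rank A = nc"
  shows "distinct (cols A)" and "lin_indpt (set (cols A))"
proof -
  obtain S where S: "maximal S (\<lambda>T. T \<subseteq> set (cols A) \<and> lin_indpt T)"
    using maximal_exists[of "(\<lambda>T. T \<subseteq> set (cols A) \<and> lin_indpt T)" "card (set (cols A))" "{}"]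
    by (meson List.finite_set card_mono empty_iff empty_subsetI finite_lin_indpt2 rev_finite_subset)
  have "card S \<le> card (set (cols A))"
    using S by (simp add: card_mono maximal_def)
  moreover have "card S = nc" using rank_card_indpt[OF A S] rank by simp
  ultimately show "distinct (cols A)"
    using A card_length[of "cols A"] by (intro card_distinct) auto
  then show "lin_indpt (set (cols A))" by (rule full_rank_lin_indpt[OF A rank])
qed

text \<open>Steinitz exchange against the unit vectors adds at most \<open>n - length us\<close>
  vectors, and a spanning set of an \<open>n\<close>-dimensional space has at least \<open>n\<close>
  elements, so the count is exact.\<close>

lemma (in vec_space) extend_to_spanning_list:
  assumes li: "lin_indpt (set us)" and dist: "distinct us" and us: "set us \<subseteq> carrier_vec n"
  obtains ws where "set ws \<subseteq> carrier_vec n" "length (us @ ws) = n"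
    "span (set (us @ ws)) = carrier_vec n" "distinct (us @ ws)"
proof -
  have B: "basis (set (unit_vecs n))" by (rule unit_vecs_basis)
  have spanB: "span (set (unit_vecs n)) = carrier_vec n" using B by (simp add: basis_def)
  have us': "set us \<subseteq> span (set (unit_vecs n))" using us spanB by simp
  obtain C where C: "finite C" "C \<subseteq> carrier_vec n" "C \<inter> set us = {}"
      "int (card C) \<le> int (card (set (unit_vecs n :: 'a vec list))) - int (card (set us))"
      "span (set us \<union> C) = carrier_vec n"
    using replacement[OF finite_set finite_set unit_vecs_carrier li us']
    unfolding spanB by blast
  obtain ws where ws: "set ws = C" "distinct ws"
    using finite_distinct_list[OF C(1)] by blast
  have dist': "distinct (us @ ws)" using dist ws C(3) by auto
  have "card (set (unit_vecs n :: 'a vec list)) \<le> n"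
    using card_length[of "unit_vecs n :: 'a vec list"] by simp
  then have "card (set us) + card C \<le> n" using C(4) by linarith
  then have le: "length (us @ ws) \<le> n"
    using dist ws by (simp add: distinct_card[symmetric])
  have "n \<le> card (set us \<union> C)"
    using gen_ge_dim[of "set us \<union> C"] C us dim_is_n by auto
  then have "n \<le> length (us @ ws)"
    using card_length[of "us @ ws"] ws by simp
  with le have "length (us @ ws) = n" by simp
  then show ?thesis
    using that[of ws] C dist' ws by simp
qed

text \<open>\<open>H\<close> consists of the columns of \<open>A\<close> followed by the completing
  vectors, and \<open>G\<close> is its inverse. The right factor selects the first \<open>nc\<close>
  columns.\<close>

lemma (in vec_space) full_rank_factorization:
  assumes A: "A \<in> carrier_mat n nc" and rank: "rank A = nc"
  obtains H G where "H \<in> carrier_mat n n" "G \<in> carrier_mat n n" "G * H = 1\<^sub>m n" "H * G = 1\<^sub>m n"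
    "A = H * mat n nc (\<lambda>(i, j). if i = j then 1 else 0)"
proof -
  have us: "set (cols A) \<subseteq> carrier_vec n" using A cols_dim by blast
  obtain ws where ws: "set ws \<subseteq> carrier_vec n" "length (cols A @ ws) = n"
    "span (set (cols A @ ws)) = carrier_vec n" "distinct (cols A @ ws)"
    using extend_to_spanning_list[OF full_rank_cols(2)[OF A rank] full_rank_cols(1)[OF A rank] us]
    by metis
  define H where "H = mat_of_cols n (cols A @ ws)"
  have H: "H \<in> carrier_mat n n"
    using mat_of_cols_carrier(1)[of n "cols A @ ws"] unfolding H_def ws(2) .
  have colsH: "cols H = cols A @ ws" unfolding H_def
    by (rule cols_mat_of_cols) (use us ws in auto)
  \<comment> \<open>A spanning set of \<open>n\<close> vectors in dimension \<open>n\<close> is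
    independent, so \<open>H\<close> has full rank and a nonzero determinant.\<close>
  have "basis (set (cols H))"
    by (rule dim_gen_is_basis) (use us ws colsH dim_is_n distinct_card[of "cols A @ ws"] in auto)
  then have "rank H = n"
    using lin_indpt_full_rank[OF H] ws(4) colsH by (auto simp: basis_def)
  then have "det H \<noteq> 0" using det_rank_iff[OF H] by simp
  then obtain G where G: "G \<in> carrier_mat n n" "G * H = 1\<^sub>m n" "H * G = 1\<^sub>m n"
    using det_non_zero_imp_unit[OF H]
    by (auto simp: Units_def ring_mat_def)
  have nc: "nc \<le> n" using ws(2) A by auto
  let ?J = "mat n nc (\<lambda>(i, j). if i = j then 1 else 0) :: 'a mat"
  have "A = H * ?J"
  proof (rule eq_matI)
    fix i j assume ij: "i < dim_row (H * ?J)" "j < dim_col (H * ?J)"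
    then have i: "i < n" and j: "j < nc" using H by auto
    have "col ?J j = unit_vec n j" using j nc by (intro eq_vecI) auto
    then have "(H * ?J) $$ (i, j) = H $$ (i, j)" using i j nc H by simp
    also have "\<dots> = col H j $ i" using i j nc H by simp
    also have "col H j = cols H ! j" using j nc H by simp
    also have "\<dots> = col A j" using colsH j A by (simp add: nth_append)
    finally show "A $$ (i, j) = (H * ?J) $$ (i, j)" using i j A by simp
  qed (use A H in auto)
  then show ?thesis using that H G by blast
qed

text \<open>Rank-nullity with trivial kernel. Restricting the carrier of \<open>W\<close> to the
  image matches the form of \<open>mat_subspace_dim\<close>.\<close>

lemma linear_inj_dim_image:
  assumes lin: "linear_map K V W T"
    and fd: "vectorspace.fin_dim K V"
    and inj: "inj_on T (carrier V)"
  shows "vectorspace.dim K (W\<lparr>carrier := T ` carrier V\<rparr>) = vectorspace.dim K V"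
proof -
  interpret linear_map K V W T by (rule lin)
  show ?thesis
    using rank_nullity[OF fd] inj_imp_dim_ker0[OF inj] by (simp add: im_def)
qed

section \<open>The tangent space at the first \<open>d\<close> columns of the identity\<close>

text \<open>Coordinates for the tangent space at the first \<open>d\<close> columns of the identity: symmetric
  matrices whose lower right block of size \<open>n - d\<close> vanishes. The map \<open>g\<close> enumerates the free
  entries, those on or above the diagonal in the first \<open>d\<close> rows.\<close>

definition sym_of_vec :: "nat \<Rightarrow> nat \<Rightarrow> (nat \<times> nat \<Rightarrow> nat) \<Rightarrow> real vec \<Rightarrow> real mat" where
  "sym_of_vec n d g v = mat n n (\<lambda>(i, j). if min i j < d then v $ g (min i j, max i j) else 0)"

lemma sym_of_vec_carrier [simp]: "sym_of_vec n d g v \<in> carrier_mat n n"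
  by (simp add: sym_of_vec_def)

definition upper_indices :: "nat \<Rightarrow> nat \<Rightarrow> (nat \<times> nat) set" where
  "upper_indices n d = (SIGMA i:{..<d}. {i..<n})"

lemma upper_indices_iff [simp]: "(i, j) \<in> upper_indices n d \<longleftrightarrow> i < d \<and> i \<le> j \<and> j < n"
  by (auto simp: upper_indices_def)

lemma finite_upper_indices: "finite (upper_indices n d)"
  by (simp add: upper_indices_def)

lemma card_upper_indices:
  assumes "d \<le> n"
  shows "real (card (upper_indices n d)) = real n * real d - real d * (real d - 1) / 2"
proof -
  have "card (upper_indices n d) = (\<Sum>i<d. n - i)"
    by (simp add: upper_indices_def)
  also have "real \<dots> = real n * real d - real d * (real d - 1) / 2"
    \<comment> \<open>Row \<open>i\<close> contributes \<open>n - i\<close> entries;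
      \<open>d \<le> n\<close> makes this natural subtraction exact.\<close>
    using assms by (induction d) (auto simp: field_simps of_nat_diff)
  finally show ?thesis .
qed

text \<open>Every coordinate of the vector appears as an entry of the matrix, because
  \<open>g\<close> is onto \<open>{..<N}\<close>.\<close>

lemma inj_on_sym_of_vec:
  assumes g: "bij_betw g (upper_indices n d) {..<N}"
  shows "inj_on (sym_of_vec n d g) (carrier_vec N)"
proof (rule inj_onI)
  fix v w :: "real vec"
  assume v: "v \<in> carrier_vec N" and w: "w \<in> carrier_vec N"
    and eq: "sym_of_vec n d g v = sym_of_vec n d g w"
  show "v = w"
  proof (rule eq_vecI)
    fix k assume "k < dim_vec w"
    then have "k \<in> g ` upper_indices n d" using g w by (auto simp: bij_betw_def)
    then obtain i j where ij: "k = g (i, j)" "i < d" "i \<le> j" "j < n" by auto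
    have "sym_of_vec n d g v $$ (i, j) = sym_of_vec n d g w $$ (i, j)" using eq by simp
    then show "v $ k = w $ k" using ij by (simp add: sym_of_vec_def min_absorb1 max_absorb2)
  qed (use v w in auto)
qed

text \<open>\<open>C * J\<^sup>T\<close> is \<open>C\<close> padded with zero columns, and
  \<open>J * C\<^sup>T\<close> is its transpose.\<close>

lemma sym_part_index:
  fixes C :: "real mat"
  assumes C: "C \<in> carrier_mat n d" and ij: "i < n" "j < n" and dn: "d \<le> n"
  defines "J \<equiv> mat n d (\<lambda>(i, j). if i = j then 1 else 0)"
  shows "(C * J\<^sup>T + J * C\<^sup>T) $$ (i, j) =
    (if j < d then C $$ (i, j) else 0) + (if i < d then C $$ (j, i) else 0)"
proof -
  have *: "(C' * J\<^sup>T) $$ (a, b) = (if b < d then C' $$ (a, b) else 0)"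
    if "C' \<in> carrier_mat n d" "a < n" "b < n" for C' a b
  proof -
    have "(C' * J\<^sup>T) $$ (a, b) = (\<Sum>k<d. C' $$ (a, k) * (if b = k then 1 else 0))"
      using that by (simp add: J_def scalar_prod_def atLeast0LessThan)
    then show ?thesis by (simp add: if_distrib cong: if_cong)
  qed
  have J: "J \<in> carrier_mat n d" by (simp add: J_def)
  have "J * C\<^sup>T = (C * J\<^sup>T)\<^sup>T"
    using transpose_mult[of C n d "J\<^sup>T" n] C J by simp
  then show ?thesis using C J ij *[OF C ij] *[OF C ij(2,1)] by simp
qed

text \<open>The entry formula of \<open>sym_part_index\<close> shows that tangent matrices are
  symmetric with zero lower right block, hence determined by their entries in
  \<open>upper_indices\<close>; conversely, such a matrix can be solved for
  \<open>C\<close>.\<close>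

lemma sym_of_vec_image:
  assumes g: "bij_betw g (upper_indices n d) {..<N}" and dn: "d \<le> n"
  shows "sym_of_vec n d g ` carrier_vec N =
    realizable_tangent_space n d (mat n d (\<lambda>(i, j). if i = j then 1 else 0))"
    (is "?L = realizable_tangent_space n d ?J")
proof (intro equalityI subsetI)
  fix M assume "M \<in> ?L"
  then obtain v where v: "M = sym_of_vec n d g v" by auto
  \<comment> \<open>In the upper left block both summands contribute, hence the factor one half.\<close>
  define C where "C = mat n d (\<lambda>(i, j). if i < d then M $$ (i, j) / 2 else M $$ (i, j))"
  have C: "C \<in> carrier_mat n d" by (simp add: C_def)
  have "M = C * ?J\<^sup>T + ?J * C\<^sup>T"
  proof (rule eq_matI)
    fix i j assume "i < dim_row (C * ?J\<^sup>T + ?J * C\<^sup>T)" "j < dim_col (C * ?J\<^sup>T + ?J * C\<^sup>T)"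
    then have ij: "i < n" "j < n" using C by auto
    have sym: "M $$ (j, i) = M $$ (i, j)"
      using ij by (simp add: v sym_of_vec_def min.commute max.commute)
    have zero: "M $$ (i, j) = 0" if "\<not> i < d" "\<not> j < d"
      using ij that by (simp add: v sym_of_vec_def)
    show "M $$ (i, j) = (C * ?J\<^sup>T + ?J * C\<^sup>T) $$ (i, j)"
      unfolding sym_part_index[OF C ij dn]
      using ij dn sym zero by (auto simp: C_def)
  qed (use C v in \<open>auto simp: sym_of_vec_def\<close>)
  then show "M \<in> realizable_tangent_space n d ?J"
    unfolding realizable_tangent_space_def using C by blast
next
  fix M assume "M \<in> realizable_tangent_space n d ?J"
  then obtain C where C: "C \<in> carrier_mat n d" and M: "M = C * ?J\<^sup>T + ?J * C\<^sup>T"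
    unfolding realizable_tangent_space_def by blast
  \<comment> \<open>\<open>h\<close> inverts the enumeration, so \<open>v\<close> lists the free
    entries of \<open>M\<close>.\<close>
  define h where "h = inv_into (upper_indices n d) g"
  define v where "v = vec N (\<lambda>k. M $$ h k)"
  have "sym_of_vec n d g v = M"
  proof (rule eq_matI)
    fix i j assume "i < dim_row M" "j < dim_col M"
    then have ij: "i < n" "j < n" using M C by auto
    have sym: "M $$ (j, i) = M $$ (i, j)"
      unfolding M sym_part_index[OF C ij dn] sym_part_index[OF C ij(2,1) dn] by simp
    show "sym_of_vec n d g v $$ (i, j) = M $$ (i, j)"
    proof (cases "min i j < d")
      case True
      let ?p = "(min i j, max i j)"
      have p: "?p \<in> upper_indices n d" using True ij by auto
      then have "g ?p < N" using g by (auto simp: bij_betw_def)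
      moreover have "h (g ?p) = ?p"
        unfolding h_def by (rule bij_betw_inv_into_left[OF g p])
      ultimately have "sym_of_vec n d g v $$ (i, j) = M $$ ?p"
        using True ij by (simp add: sym_of_vec_def v_def)
      also have "\<dots> = M $$ (i, j)"
        using sym by (auto simp: min_def max_def)
      finally show ?thesis .
    next
      case False
      then show ?thesis
        using ij unfolding M sym_part_index[OF C ij dn] by (auto simp: sym_of_vec_def)
    qed
  qed (use M C in \<open>auto simp: sym_of_vec_def\<close>)
  moreover have "v \<in> carrier_vec N" by (simp add: v_def)
  ultimately show "M \<in> ?L" by blast
qed

section \<open>Transport by congruence and the dimension count\<close>

text \<open>Congruence by \<open>H\<close> turns the tangent matrix of \<open>C\<close> at
  \<open>J\<close> into that of \<open>H * C\<close> at \<open>H * J\<close>. Every direction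
  \<open>Z\<close> arises in this way, from \<open>C = G * Z\<close>.\<close>

lemma realizable_tangent_space_congruence:
  assumes H: "H \<in> carrier_mat n n" and G: "G \<in> carrier_mat n n" and HG: "H * G = 1\<^sub>m n"
    and J: "J \<in> carrier_mat n d"
  shows "realizable_tangent_space n d (H * J) =
    (\<lambda>M. H * M * H\<^sup>T) ` realizable_tangent_space n d J"
proof -
  have HT: "H\<^sup>T \<in> carrier_mat n n" using H by simp
  have key: "H * (C * J\<^sup>T + J * C\<^sup>T) * H\<^sup>T = (H * C) * (H * J)\<^sup>T + (H * J) * (H * C)\<^sup>T"
    if C: "C \<in> carrier_mat n d" for C
  proof -
    have tr: "(H * J)\<^sup>T = J\<^sup>T * H\<^sup>T" "(H * C)\<^sup>T = C\<^sup>T * H\<^sup>T"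
      using transpose_mult[OF H J] transpose_mult[OF H C] by auto
    have assoc: "H * (A * B\<^sup>T) * H\<^sup>T = (H * A) * (B\<^sup>T * H\<^sup>T)"
      if A: "A \<in> carrier_mat n d" and B: "B \<in> carrier_mat n d" for A B
    proof -
      have BT: "B\<^sup>T \<in> carrier_mat d n" using B by simp
      have "H * (A * B\<^sup>T) = H * A * B\<^sup>T" using assoc_mult_mat[OF H A BT] by simp
      then show ?thesis
        using assoc_mult_mat[OF mult_carrier_mat[OF H A] BT HT] by simp
    qed
    have CJ: "C * J\<^sup>T \<in> carrier_mat n n" and JC: "J * C\<^sup>T \<in> carrier_mat n n" using C J by auto
    have "H * (C * J\<^sup>T + J * C\<^sup>T) * H\<^sup>T = (H * (C * J\<^sup>T) + H * (J * C\<^sup>T)) * H\<^sup>T"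
      using mult_add_distrib_mat[OF H CJ JC] by simp
    also have "\<dots> = H * (C * J\<^sup>T) * H\<^sup>T + H * (J * C\<^sup>T) * H\<^sup>T"
      by (rule add_mult_distrib_mat[of _ n n]) (use H CJ JC in auto)
    finally show ?thesis unfolding tr assoc[OF C J] assoc[OF J C] .
  qed
  show ?thesis
  proof (intro equalityI subsetI)
    fix M assume "M \<in> realizable_tangent_space n d (H * J)"
    then obtain Z where Z: "Z \<in> carrier_mat n d" and M: "M = Z * (H * J)\<^sup>T + (H * J) * Z\<^sup>T"
      unfolding realizable_tangent_space_def by blast
    have GZ: "G * Z \<in> carrier_mat n d" using G Z by simp
    have "H * (G * Z) = Z" using assoc_mult_mat[OF H G Z] HG Z by simp
    then have "M = H * ((G * Z) * J\<^sup>T + J * (G * Z)\<^sup>T) * H\<^sup>T"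
      unfolding key[OF GZ] M by simp
    then show "M \<in> (\<lambda>M. H * M * H\<^sup>T) ` realizable_tangent_space n d J"
      unfolding realizable_tangent_space_def using GZ by blast
  next
    fix M assume "M \<in> (\<lambda>M. H * M * H\<^sup>T) ` realizable_tangent_space n d J"
    then obtain C where C: "C \<in> carrier_mat n d" and M: "M = H * (C * J\<^sup>T + J * C\<^sup>T) * H\<^sup>T"
      unfolding realizable_tangent_space_def by blast
    have "H * C \<in> carrier_mat n d" using H C by simp
    then show "M \<in> realizable_tangent_space n d (H * J)"
      unfolding realizable_tangent_space_def M key[OF C] by blast
  qed
qed

text \<open>Congruence by \<open>G\<close> is a left inverse, since transposing
  \<open>G * H = 1\<^sub>m n\<close> makes \<open>G\<^sup>T\<close> a right inverse of
  \<open>H\<^sup>T\<close>.\<close>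

lemma inj_on_congruence:
  fixes H :: "'a :: field mat"
  assumes H: "H \<in> carrier_mat n n" and G: "G \<in> carrier_mat n n" and GH: "G * H = 1\<^sub>m n"
  shows "inj_on (\<lambda>M. H * M * H\<^sup>T) (carrier_mat n n)"
proof (rule inj_on_inverseI)
  fix M :: "'a mat" assume M: "M \<in> carrier_mat n n"
  have HT: "H\<^sup>T \<in> carrier_mat n n" and GT: "G\<^sup>T \<in> carrier_mat n n" using H G by auto
  have HM: "H * M \<in> carrier_mat n n" using H M by simp
  have "H\<^sup>T * G\<^sup>T = 1\<^sub>m n" using transpose_mult[OF G H] GH by simp
  then have "(H * M * H\<^sup>T) * G\<^sup>T = H * M"
    using assoc_mult_mat[OF HM HT GT] right_mult_one_mat[OF HM] by simp
  then show "G * ((H * M * H\<^sup>T) * G\<^sup>T) = M"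
    using assoc_mult_mat[OF G H M] GH M by simp
qed

lemma linear_map_sym_of_vec:
  assumes g: "bij_betw g (upper_indices n d) {..<N}" and H: "H \<in> carrier_mat n n"
  shows "linear_map class_ring (module_vec TYPE(real) N) (module_mat TYPE(real) n n)
    (\<lambda>v. H * sym_of_vec n d g v * H\<^sup>T)"
proof -
  have HT: "H\<^sup>T \<in> carrier_mat n n" using H by simp
  \<comment> \<open>Sums and multiples of vectors can be evaluated componentwise only at indices
    below the dimension.\<close>
  have lt: "g (min i j, max i j) < N" if "i < n" "j < n" "min i j < d" for i j
    using g that by (auto simp: bij_betw_def)
  have add: "sym_of_vec n d g (v + w) = sym_of_vec n d g v + sym_of_vec n d g w"
    if "v \<in> carrier_vec N" "w \<in> carrier_vec N" for v w
    using that lt by (intro eq_matI) (auto simp: sym_of_vec_def)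
  have smult: "sym_of_vec n d g (c \<cdot>\<^sub>v v) = c \<cdot>\<^sub>m sym_of_vec n d g v"
    if "v \<in> carrier_vec N" for c v
    using that lt by (intro eq_matI) (auto simp: sym_of_vec_def)
  have add': "H * (A + B) * H\<^sup>T = H * A * H\<^sup>T + H * B * H\<^sup>T"
    if "A \<in> carrier_mat n n" "B \<in> carrier_mat n n" for A B
    using mult_add_distrib_mat[OF H that]
      add_mult_distrib_mat[OF mult_carrier_mat[OF H that(1)] mult_carrier_mat[OF H that(2)] HT]
    by simp
  have smult': "H * (c \<cdot>\<^sub>m A) * H\<^sup>T = c \<cdot>\<^sub>m (H * A * H\<^sup>T)" if A: "A \<in> carrier_mat n n" for c A
    using mult_smult_distrib[OF H A] mult_smult_assoc_mat[OF mult_carrier_mat[OF H A] HT] by simp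
  show ?thesis
    unfolding linear_map_def mod_hom_def mod_hom_axioms_def LinearCombinations.module_hom_def
    using H vec_vs[where ?'a = real] matrix_vs[where ?'a = real]
      vec_module[where ?'a = real] vectorspace.axioms(1)[OF matrix_vs[where ?'a = real]]
    by (auto simp: module_vec_simps module_mat_simps add smult add' smult')
qed

text \<open>Filling in the free entries and then applying the congruence by \<open>H\<close> is an
  injective linear map from the vectors of length \<open>N\<close> onto the tangent space at
  \<open>X\<close>.\<close>

lemma dim_realizable_tangent_space:
  assumes dn: "d \<le> n" and X: "X \<in> carrier_mat n d" and rank: "vec_space.rank n X = d"
  shows "mat_subspace_dim n (realizable_tangent_space n d X) = card (upper_indices n d)"
proof -
  let ?J = "mat n d (\<lambda>(i, j). if i = j then 1 else 0) :: real mat"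
  define N where "N = card (upper_indices n d)"
  obtain g where g: "bij_betw g (upper_indices n d) {..<N}"
    using ex_bij_betw_finite_nat[OF finite_upper_indices] unfolding N_def atLeast0LessThan by blast
  obtain H G where H: "H \<in> carrier_mat n n" and G: "G \<in> carrier_mat n n"
    and GH: "G * H = 1\<^sub>m n" and HG: "H * G = 1\<^sub>m n" and X': "X = H * ?J"
    using vec_space.full_rank_factorization[OF X rank] by metis
  let ?T = "\<lambda>v. H * sym_of_vec n d g v * H\<^sup>T"
  interpret VN: vec_space "TYPE(real)" N .
  have "inj_on (\<lambda>M. H * M * H\<^sup>T) (sym_of_vec n d g ` carrier_vec N)"
    by (rule inj_on_subset[OF inj_on_congruence[OF H G GH]]) auto
  from comp_inj_on[OF inj_on_sym_of_vec[OF g] this]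
  have inj: "inj_on ?T (carrier_vec N)" by (simp add: comp_def)
  have img: "?T ` carrier_vec N = realizable_tangent_space n d X"
    unfolding X' realizable_tangent_space_congruence[OF H G HG mat_carrier]
      sym_of_vec_image[OF g dn, symmetric] by (simp add: image_image)
  show ?thesis
    using linear_inj_dim_image[OF linear_map_sym_of_vec[OF g H] VN.fin_dim] inj
    unfolding mat_subspace_dim_def N_def[symmetric]
    by (simp add: img VN.dim_is_n)
qed

section \<open>Vanishing of the normal block\<close>

text \<open>For \<open>v\<close> orthogonal to the range of \<open>X X\<^sup>T\<close> one has
  \<open>\<bar>X\<^sup>T v\<bar>\<^sup>2 = v \<bullet> X X\<^sup>T v = 0\<close>.\<close>

lemma orth_compl_gram_kernel:
  fixes X :: "real mat"
  assumes X: "X \<in> carrier_mat n d"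
    and v: "v \<in> real_orth_compl n (real_col_space n (X * X\<^sup>T))"
  shows "X\<^sup>T *\<^sub>v v = 0\<^sub>v d"
proof -
  interpret vec_space "TYPE(real)" n .
  have vn: "v \<in> carrier_vec n" using v by (simp add: orthogonal_complement_def)
  have XT: "X\<^sup>T \<in> carrier_mat d n" using X by simp
  let ?u = "X\<^sup>T *\<^sub>v v"
  have u: "?u \<in> carrier_vec d" using XT vn by simp
  have "(X * X\<^sup>T) *\<^sub>v v \<in> col_space (X * X\<^sup>T)"
    using col_space_eq[of "X * X\<^sup>T" n] X vn by auto
  then have "v \<bullet> ((X * X\<^sup>T) *\<^sub>v v) = 0" using v by (simp add: orthogonal_complement_def)
  moreover have "v \<bullet> ((X * X\<^sup>T) *\<^sub>v v) = v \<bullet> (X *\<^sub>v ?u)"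
    using assoc_mult_mat_vec[OF X XT vn] by simp
  moreover have "v \<bullet> (X *\<^sub>v ?u) = ?u \<bullet> ?u"
    using transpose_vec_mult_scalar[OF X u vn] by simp
  ultimately have "?u \<bullet> ?u = 0" by simp
  then show ?thesis using conjugate_square_eq_0_vec[OF u] by simp
qed

text \<open>The columns of \<open>W\<close> lie in the kernel of \<open>X\<^sup>T\<close>. Thus
  \<open>X\<^sup>T * W = 0\<close> kills the first summand of \<open>Q\<close> from the right, and
  its transpose kills the second from the left.\<close>

lemma normal_block_vanishes:
  fixes X :: "real mat"
  assumes X: "X \<in> carrier_mat n d" and W: "W \<in> carrier_mat n m"
    and orth: "real_col_space n W \<subseteq> real_orth_compl n (real_col_space n (X * X\<^sup>T))"
    and Q: "Q \<in> realizable_tangent_space n d X"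
  shows "W\<^sup>T * Q * W = 0\<^sub>m m m"
proof -
  interpret vec_space "TYPE(real)" n .
  obtain Z where Z: "Z \<in> carrier_mat n d" and Qeq: "Q = Z * X\<^sup>T + X * Z\<^sup>T"
    using Q unfolding realizable_tangent_space_def by blast
  have XT: "X\<^sup>T \<in> carrier_mat d n" and WT: "W\<^sup>T \<in> carrier_mat m n"
    and ZT: "Z\<^sup>T \<in> carrier_mat d n" using X W Z by auto
  have XW: "X\<^sup>T * W = 0\<^sub>m d m"
  proof (rule mat_col_eqI)
    fix j assume "j < dim_col (0\<^sub>m d m :: real mat)"
    then have j: "j < m" by simp
    have "col W j \<in> col_space W"
      unfolding col_space_def
      by (rule subsetD[OF in_own_span]) (use W j cols_dim[of W] in \<open>auto simp: cols_def\<close>)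
    then have "X\<^sup>T *\<^sub>v col W j = 0\<^sub>v d"
      using orth_compl_gram_kernel[OF X] orth by blast
    then show "col (X\<^sup>T * W) j = col (0\<^sub>m d m) j"
      using col_mult2[OF XT W j] j by simp
  qed (use X W in auto)
  have WX: "W\<^sup>T * X = 0\<^sub>m m d"
    using transpose_mult[OF XT W] XW by simp
  have "Q * W = Z * (X\<^sup>T * W) + X * (Z\<^sup>T * W)"
    unfolding Qeq using add_mult_distrib_mat[of "Z * X\<^sup>T" n n "X * Z\<^sup>T" W m]
      assoc_mult_mat[OF Z XT W] assoc_mult_mat[OF X ZT W] X Z W by simp
  also have "\<dots> = X * (Z\<^sup>T * W)" using XW X Z W by simp
  finally have QW: "Q * W = X * (Z\<^sup>T * W)" .
  have Qc: "Q \<in> carrier_mat n n" using Qeq X Z by simp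
  have ZW: "Z\<^sup>T * W \<in> carrier_mat d m" using ZT W by simp
  have "W\<^sup>T * Q * W = W\<^sup>T * (X * (Z\<^sup>T * W))"
    using assoc_mult_mat[OF WT Qc W] QW by simp
  also have "\<dots> = (W\<^sup>T * X) * (Z\<^sup>T * W)" using assoc_mult_mat[OF WT X ZW] by simp
  also have "\<dots> = 0\<^sub>m m m" unfolding WX by (rule left_mult_zero_mat[OF ZW])
  finally show ?thesis .
qed

theorem proposition1:
  fixes n d :: nat and X P :: "real mat"
  assumes "n \<ge> d" and "d \<ge> 2"
    and "X \<in> carrier_mat n d" and "vec_space.rank n X = d"
    and "P = X * X\<^sup>T"
  shows "(\<forall>V Vperp Pdot.
            V \<in> carrier_mat n d \<and> orthonormal_cols V \<and>
            real_col_space n V = real_col_space n P \<and>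
            Vperp \<in> carrier_mat n (n - d) \<and>
            real_col_space n Vperp = real_orth_compl n (real_col_space n P) \<and>
            Pdot \<in> realizable_tangent_space n d X \<longrightarrow>
            Vperp\<^sup>T * Pdot * Vperp = 0\<^sub>m (n - d) (n - d)) \<and>
         real (mat_subspace_dim n (realizable_tangent_space n d X)) =
           real n * real d - real d * (real d - 1) / 2"
proof (intro conjI allI impI)
  fix V Vperp Pdot :: "real mat"
  assume "V \<in> carrier_mat n d \<and> orthonormal_cols V \<and>
    real_col_space n V = real_col_space n P \<and>
    Vperp \<in> carrier_mat n (n - d) \<and>
    real_col_space n Vperp = real_orth_compl n (real_col_space n P) \<and>
    Pdot \<in> realizable_tangent_space n d X"
  then show "Vperp\<^sup>T * Pdot * Vperp = 0\<^sub>m (n - d) (n - d)"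
    using assms(5) by (intro normal_block_vanishes[OF assms(3)]) auto
next
  show "real (mat_subspace_dim n (realizable_tangent_space n d X)) =
      real n * real d - real d * (real d - 1) / 2"
    unfolding dim_realizable_tangent_space[OF assms(1,3,4)] by (rule card_upper_indices[OF assms(1)])
qed

end
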